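(* Let $n$ and $t$ be positive integers and let $P\subseteq[0,1]^n$ be the $n$-dimensional cropped cube. Then the $t$-dimensional lattice rank of $P$ is at least $\lceil\frac{n}{t}\rceil$.
   Context: The $n$-dimensional cropped cube is the polytope in $\mathbb{R}^n$ defined by the constraints $\sum_{i\in J}x_i+\sum_{i\notin J}(1-x_i)\ge\frac12$ for all $J\subseteq\{1,\dots,n\}$, and $0\le x_i\le1$ for all $i\in\{1,\dots,n\}$. For $P\subseteq\mathbb{R}^n$, the $t$-dimensional lattice closure of $P$ is $$tLC(P)=\bigcap_{\pi^1,\dots,\pi^t\in\mathbb{Z}^n}\mathrm{conv}\Big(\bigcap_{j=1}^t\{x\in P:\pi^j x\in\mathbb{Z}\}\Big),$$ where $\pi x$ denotes the inner product of $\pi$ and $x$. Put $tLC^0(P)=P$ and $tLC^k(P)=tLC(tLC^{k-1}(P))$ for $k\ge1$. Let $P_I$ denote the convex hull of the integral points of $P$. The $t$-dimensional lattice rank of $P$ is the minimum $k\ge0$ such that $tLC^k(P)=P_I$. *)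

theory Defs
  imports "HOL-Analysis.Analysis" "HOL-Library.Extended_Nat"
begin

definition integer_vectors :: "(real ^ 'n) set" where
  "integer_vectors = {x. \<forall>i. x $ i \<in> \<int>}"

definition cropped_cube :: "(real ^ 'n) set" where
  "cropped_cube =
     {x. (\<forall>J. (\<Sum>i\<in>J. x $ i) + (\<Sum>i\<in>-J. 1 - x $ i) \<ge> 1 / 2) \<and>
         (\<forall>i. 0 \<le> x $ i \<and> x $ i \<le> 1)}"

definition lattice_closure :: "nat \<Rightarrow> (real ^ 'n) set \<Rightarrow> (real ^ 'n) set" where
  "lattice_closure t P =
     (\<Inter>\<pi> \<in> {1..t} \<rightarrow> integer_vectors.
        convex hull (\<Inter>j\<in>{1..t}. {x \<in> P. \<pi> j \<bullet> x \<in> \<int>}))"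

definition integer_hull :: "(real ^ 'n) set \<Rightarrow> (real ^ 'n) set" where
  "integer_hull P = convex hull (P \<inter> integer_vectors)"

text \<open>The minimum is taken in \<^typ>\<open>enat\<close>, so the rank is \<open>\<infinity>\<close> if no iterate of the closure
  reaches the integer hull.\<close>

definition lattice_rank :: "nat \<Rightarrow> (real ^ 'n) set \<Rightarrow> enat" where
  "lattice_rank t P = (INF k \<in> {k. (lattice_closure t ^^ k) P = integer_hull P}. enat k)"

end

theory Submission imports Defs begin

text \<open>
  No vertex of the unit cube lies in the cropped cube, so its integer hull is empty, and the
  rank is at least \<open>k + 1\<close> as soon as \<open>k\<close> rounds of the closure leave a point behind. The points
  that survive are the half-integral ones, with coordinates in \<open>{0, 1/2, 1}\<close>: having a
  single coordinate \<open>1/2\<close> puts such a point into the cropped cube, and each round costs at most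
  \<open>t\<close> further coordinates \<open>1/2\<close>.

  To see the latter, let \<open>x\<close> be half-integral, let \<open>H\<close> be the set of coordinates where it is
  \<open>1/2\<close>, and let \<open>\<pi> 1, \<dots>, \<pi> t\<close> be integral. Rounding the coordinates in some \<open>S \<subseteq> H\<close> all up, or
  all down, gives two points whose midpoint is \<open>x\<close>. The inner product of \<open>\<pi> j\<close> with either of
  them is an integer exactly if \<open>\<pi> j\<close> has an even sum over \<open>H - S\<close>. Over the field with two
  elements these are \<open>t\<close> linear conditions on the indicator of \<open>S\<close>, solved by \<open>S = H\<close>; a
  smallest solution has linearly independent columns, hence at most \<open>t\<close> elements
  (\<open>small_set_with_even_remainder\<close>). So \<open>x\<close> stays in the closure if it has \<open>t\<close> more
  coordinates \<open>1/2\<close> than are needed for points of the previous round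
  (\<open>half_integral_points_subset_iterate\<close>). The centre of the cube has \<open>n\<close>
  of them, and therefore it survives every round \<open>k\<close> with \<open>k t < n\<close>.
\<close>

text \<open>
  Subsets of \<open>S\<close> have at most \<open>2 ^ card T\<close> parity patterns, so if \<open>S\<close> has more than
  \<open>card T\<close> elements, then two different subsets share their pattern. Their symmetric difference
  has even sums and can be dropped from \<open>S\<close>; hence a smallest \<open>S\<close> is small enough.
\<close>

lemma small_set_with_even_remainder:
  fixes a :: "'b \<Rightarrow> 'a \<Rightarrow> int"
  assumes "finite H" and "finite T"
  shows "\<exists>S\<subseteq>H. card S \<le> card T \<and> (\<forall>j\<in>T. even (\<Sum>i\<in>H - S. a j i))"
proof -
  let ?ok = "\<lambda>S. S \<subseteq> H \<and> (\<forall>j\<in>T. even (\<Sum>i\<in>H - S. a j i))"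
  have "?ok H" by simp
  then obtain S where S: "?ok S" and minimal: "\<And>S'. ?ok S' \<Longrightarrow> card S \<le> card S'"
    using exists_least_iff[of "\<lambda>m. \<exists>S. ?ok S \<and> card S = m"]
    by (metis (no_types, lifting) not_le)
  have fin: "finite S" using S assms(1) finite_subset by blast
  have "card S \<le> card T"
  proof (rule ccontr)
    assume "\<not> card S \<le> card T"
    then have "card (Pow T) < card (Pow S)"
      using fin assms(2) by (simp add: card_Pow)
    moreover define pattern where "pattern A = {j\<in>T. odd (\<Sum>i\<in>A. a j i)}" for A
    have "pattern ` Pow S \<subseteq> Pow T"
      by (auto simp: pattern_def)
    ultimately have "\<not> inj_on pattern (Pow S)"
      using card_inj_on_le[of pattern "Pow S" "Pow T"] assms(2) by auto
    then obtain A B where AB: "A \<subseteq> S" "B \<subseteq> S" "A \<noteq> B" "pattern A = pattern B"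
      by (auto simp: inj_on_def)
    define D where "D = (A - B) \<union> (B - A)"
    have D: "D \<subseteq> S" "D \<noteq> {}" using AB by (auto simp: D_def)
    have finAB: "finite A" "finite B" using AB fin finite_subset by blast+
    have even_D: "even (\<Sum>i\<in>D. a j i)" if "j \<in> T" for j
    proof -
      have "(\<Sum>i\<in>D. a j i) = (\<Sum>i\<in>A - B. a j i) + (\<Sum>i\<in>B - A. a j i)"
        unfolding D_def using finAB by (intro sum.union_disjoint) auto
      moreover have "(\<Sum>i\<in>A. a j i) = (\<Sum>i\<in>A \<inter> B. a j i) + (\<Sum>i\<in>A - B. a j i)"
        using finAB(1) by (rule sum.Int_Diff)
      moreover have "(\<Sum>i\<in>B. a j i) = (\<Sum>i\<in>A \<inter> B. a j i) + (\<Sum>i\<in>B - A. a j i)"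
        using finAB sum.Int_Diff[of B "a j" A] by (simp add: Int_commute)
      moreover have "even (\<Sum>i\<in>A. a j i) = even (\<Sum>i\<in>B. a j i)"
        using AB(4) that by (auto simp: pattern_def)
      ultimately show ?thesis by (simp only: even_add) blast
    qed
    have "?ok (S - D)"
    proof (intro conjI ballI)
      fix j assume "j \<in> T"
      have "H - (S - D) = (H - S) \<union> D" using S D by auto
      then have "(\<Sum>i\<in>H - (S - D). a j i) = (\<Sum>i\<in>H - S. a j i) + (\<Sum>i\<in>D. a j i)"
        using D fin assms(1) by (auto intro!: sum.union_disjoint intro: finite_subset)
      then show "even (\<Sum>i\<in>H - (S - D). a j i)"
        using even_D[OF \<open>j \<in> T\<close>] S \<open>j \<in> T\<close> by simp
    qed (use S in auto)
    moreover have "card (S - D) < card S"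
      using D fin by (intro psubset_card_mono) auto
    ultimately show False using minimal[of "S - D"] by simp
  qed
  then show ?thesis using S by blast
qed

definition half_integral_points :: "nat \<Rightarrow> (real ^ 'n) set" where
  "half_integral_points m =
     {x. (\<forall>i. x $ i \<in> {0, 1 / 2, 1}) \<and> m \<le> card {i. x $ i = 1 / 2}}"

text \<open>
  A coordinate \<open>1/2\<close> alone contributes \<open>1/2\<close> to the left-hand side of every constraint,
  whether it is counted as \<open>x $ i\<close> or as \<open>1 - x $ i\<close>.
\<close>

lemma half_integral_points_subset_cropped_cube:
  "half_integral_points 1 \<subseteq> (cropped_cube :: (real ^ 'n) set)"
proof
  fix x :: "real ^ 'n"
  assume "x \<in> half_integral_points 1"
  then have x: "\<And>i. x $ i \<in> {0, 1 / 2, 1}" and "1 \<le> card {i. x $ i = 1 / 2}"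
    unfolding half_integral_points_def by blast+
  then have "{i. x $ i = 1 / 2} \<noteq> {}" by (metis card.empty not_one_le_zero)
  then obtain h where h: "x $ h = 1 / 2" by blast
  have bounds: "0 \<le> x $ i \<and> x $ i \<le> 1" for i using x[of i] by auto
  have "(\<Sum>i\<in>J. x $ i) + (\<Sum>i\<in>-J. 1 - x $ i) \<ge> 1 / 2" for J
  proof (cases "h \<in> J")
    case True
    then have "x $ h \<le> (\<Sum>i\<in>J. x $ i)"
      using bounds by (intro member_le_sum) auto
    moreover have "0 \<le> (\<Sum>i\<in>-J. 1 - x $ i)"
      using bounds by (intro sum_nonneg) simp
    ultimately show ?thesis using h by simp
  next
    case False
    then have "1 - x $ h \<le> (\<Sum>i\<in>-J. 1 - x $ i)"
      using bounds by (intro member_le_sum[where f = "\<lambda>i. 1 - x $ i"]) auto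
    moreover have "0 \<le> (\<Sum>i\<in>J. x $ i)"
      using bounds by (intro sum_nonneg) simp
    ultimately show ?thesis using h by simp
  qed
  then show "x \<in> cropped_cube"
    using bounds by (simp add: cropped_cube_def)
qed

text \<open>
  The coordinates in \<open>H\<close> contribute half the sum of \<open>p\<close> over \<open>H\<close>. The floor only turns the
  integral entries of \<open>p\<close> into values of type \<^typ>\<open>int\<close>, where parity is available.
\<close>

lemma inner_half_integral_in_Ints:
  fixes p y :: "real ^ 'n"
  assumes p: "p \<in> integer_vectors"
    and y: "\<And>i. i \<notin> H \<Longrightarrow> y $ i \<in> \<int>" "\<And>i. i \<in> H \<Longrightarrow> y $ i = 1 / 2"
    and even: "even (\<Sum>i\<in>H. \<lfloor>p $ i\<rfloor>)"
  shows "p \<bullet> y \<in> \<int>"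
proof -
  have p_int: "p $ i \<in> \<int>" for i using p by (simp add: integer_vectors_def)
  obtain k where k: "(\<Sum>i\<in>H. \<lfloor>p $ i\<rfloor>) = 2 * k" using even by (elim evenE)
  have "(\<Sum>i\<in>H. p $ i * y $ i) = (\<Sum>i\<in>H. of_int \<lfloor>p $ i\<rfloor>) / 2"
    unfolding sum_divide_distrib
    using y(2) p_int by (intro sum.cong) auto
  also have "\<dots> = of_int (\<Sum>i\<in>H. \<lfloor>p $ i\<rfloor>) / 2" by simp
  also have "\<dots> = of_int k" unfolding k by simp
  finally have "(\<Sum>i\<in>H. p $ i * y $ i) \<in> \<int>" by simp
  moreover have "(\<Sum>i\<in>-H. p $ i * y $ i) \<in> \<int>"
    using p_int y(1) by (intro Ints_sum Ints_mult) auto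
  moreover have "p \<bullet> y = (\<Sum>i\<in>H. p $ i * y $ i) + (\<Sum>i\<in>-H. p $ i * y $ i)"
    unfolding inner_vec_def inner_real_def
    using sum.subset_diff[of H UNIV "\<lambda>i. p $ i * y $ i"] by (simp add: Compl_eq_Diff_UNIV)
  ultimately show ?thesis by simp
qed

text \<open>
  All coordinates in the small set \<open>S\<close> are moved in the same direction at once: the lemma on
  parities controls only which coordinates stay at \<open>1/2\<close>, and the direction changes each inner
  product by an integer.
\<close>

lemma half_integral_points_subset_lattice_closure:
  fixes P :: "(real ^ 'n) set"
  assumes "half_integral_points m \<subseteq> P"
  shows "half_integral_points (m + t) \<subseteq> lattice_closure t P"
  unfolding lattice_closure_def
proof (intro subsetI INT_I)
  fix x :: "real ^ 'n" and \<pi> :: "nat \<Rightarrow> real ^ 'n"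
  assume "x \<in> half_integral_points (m + t)" and \<pi>: "\<pi> \<in> {1..t} \<rightarrow> integer_vectors"
  then have x: "\<And>i. x $ i \<in> {0, 1 / 2, 1}"
    and many: "m + t \<le> card {i. x $ i = 1 / 2}"
    by (auto simp: half_integral_points_def)
  define H where "H = {i. x $ i = 1 / 2}"
  obtain S where S: "S \<subseteq> H" "card S \<le> t"
    and even: "\<And>j. j \<in> {1..t} \<Longrightarrow> even (\<Sum>i\<in>H - S. \<lfloor>\<pi> j $ i\<rfloor>)"
    using small_set_with_even_remainder[of H "{1..t}" "\<lambda>j i. \<lfloor>\<pi> j $ i\<rfloor>"] by auto
  \<comment> \<open>\<open>y 0\<close> and \<open>y 1\<close> are \<open>x\<close> with all coordinates in \<open>S\<close> rounded down, respectively up.\<close>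
  let ?Q = "\<Inter>j\<in>{1..t}. {x \<in> P. \<pi> j \<bullet> x \<in> \<int>}"
  define y :: "real \<Rightarrow> real ^ 'n" where "y c = (\<chi> i. if i \<in> S then c else x $ i)" for c
  have y_in: "y c \<in> ?Q" if c: "c \<in> {0, 1}" for c
  proof -
    have "{i. y c $ i = 1 / 2} = H - S"
      using c by (auto simp: y_def H_def)
    moreover have "m \<le> card (H - S)"
      using S many card_Diff_subset[of S H] by (simp add: H_def)
    moreover have "y c $ i \<in> {0, 1 / 2, 1}" for i
      using c x[of i] by (auto simp: y_def)
    ultimately have "y c \<in> half_integral_points m"
      unfolding half_integral_points_def by (intro CollectI conjI allI) (simp_all only:)
    then have "y c \<in> P" using assms by blast
    moreover have "\<pi> j \<bullet> y c \<in> \<int>" if j: "j \<in> {1..t}" for j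
    proof (rule inner_half_integral_in_Ints[OF _ _ _ even[OF j]])
      show "\<pi> j \<in> integer_vectors" using \<pi> j by blast
      show "y c $ i \<in> \<int>" if "i \<notin> H - S" for i
        using that c x[of i] by (auto simp: y_def H_def)
      show "y c $ i = 1 / 2" if "i \<in> H - S" for i
        using that by (simp add: y_def H_def)
    qed
    ultimately show ?thesis by simp
  qed
  have "x = (1 / 2) *\<^sub>R y 0 + (1 / 2) *\<^sub>R y 1"
    using S(1) by (auto simp: vec_eq_iff y_def H_def)
  also have "\<dots> \<in> convex hull ?Q"
    using y_in by (intro convexD convex_convex_hull hull_inc) auto
  finally show "x \<in> convex hull ?Q" .
qed

lemma half_integral_points_subset_iterate:
  "half_integral_points (k * t + 1) \<subseteq> (lattice_closure t ^^ k) (cropped_cube :: (real ^ 'n) set)"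
proof (induction k)
  case 0
  then show ?case using half_integral_points_subset_cropped_cube by simp
next
  case (Suc k)
  then show ?case
    using half_integral_points_subset_lattice_closure[OF Suc, of t] by (simp add: ac_simps)
qed

text \<open>Each vertex of the cube violates the constraint whose \<open>J\<close> is the set of its zeros.\<close>

lemma integer_hull_cropped_cube: "integer_hull (cropped_cube :: (real ^ 'n) set) = {}"
proof -
  have False if x: "x \<in> cropped_cube" "x \<in> integer_vectors" for x :: "real ^ 'n"
  proof -
    define J where "J = {i. x $ i = 0}"
    have "x $ i \<in> {0, 1}" for i
    proof -
      obtain z where "x $ i = of_int z"
        using x(2) by (auto simp: integer_vectors_def elim: Ints_cases)
      moreover have "0 \<le> x $ i" "x $ i \<le> 1" using x(1) by (auto simp: cropped_cube_def)
      ultimately show ?thesis by force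
    qed
    then have "x $ i = 1" if "i \<in> -J" for i
      using that by (auto simp: J_def)
    then have "(\<Sum>i\<in>-J. 1 - x $ i) = 0" by simp
    moreover have "(\<Sum>i\<in>J. x $ i) = 0" by (simp add: J_def)
    moreover have "(\<Sum>i\<in>J. x $ i) + (\<Sum>i\<in>-J. 1 - x $ i) \<ge> 1 / 2"
      using x(1) by (auto simp: cropped_cube_def)
    ultimately show False by simp
  qed
  then show ?thesis by (auto simp: integer_hull_def)
qed

theorem theorem4:
  fixes t :: nat
  assumes "t \<ge> 1"
  shows "lattice_rank t (cropped_cube :: (real ^ 'n) set) \<ge> enat (nat \<lceil>real CARD('n) / real t\<rceil>)"
  unfolding lattice_rank_def
proof (rule INF_greatest)
  fix k
  assume "k \<in> {k. (lattice_closure t ^^ k) (cropped_cube :: (real ^ 'n) set)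
                   = integer_hull cropped_cube}"
  then have "(lattice_closure t ^^ k) (cropped_cube :: (real ^ 'n) set) = {}"
    by (simp add: integer_hull_cropped_cube)
  then have "(\<chi> i. 1 / 2) \<notin> (half_integral_points (k * t + 1) :: (real ^ 'n) set)"
    using half_integral_points_subset_iterate by blast
  then have "CARD('n) \<le> k * t"
    by (simp add: half_integral_points_def)
  then have "real CARD('n) \<le> real k * real t"
    by (metis of_nat_le_iff of_nat_mult)
  then have "real CARD('n) / real t \<le> real k"
    using assms by (simp add: divide_le_eq)
  then have "\<lceil>real CARD('n) / real t\<rceil> \<le> int k"
    by (simp only: ceiling_le_iff of_int_of_nat_eq)
  then show "enat (nat \<lceil>real CARD('n) / real t\<rceil>) \<le> enat k"
    by (simp only: enat_ord_simps nat_le_iff)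
qed

end
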